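(* Let $a,b,m\in\mathbb{N}$, and for $j\ge0$ set $A_j:=a+jm$, $B_j:=b+jm$, $C_j:=a+b+jm$. Then, as formal power series in $q$, $$F_{a,b,m}(q)=\prod_{j\ge0}R_{A_j,B_j}(q)\;\prod_{j\ge0}\bigl(1+q^{C_{2j+1}}\bigr),$$ where the infinite products converge coefficientwise.
   Context: $\mathbb{N}$ is the set of positive integers. Notation: $(z;q)_\infty=\prod_{i\ge0}(1-zq^i)$. For $a,b,m\in\mathbb{N}$, $$F_{a,b,m}(q):=\frac{(-q^{a+b};q^m)_\infty}{(-q^a;q^m)_\infty\,(q^b;q^m)_\infty}.$$ For $A,B\in\mathbb{N}$, $$R_{A,B}(q):=\frac{1+q^{A+B}}{(1+q^A)(1-q^B)}.$$ All quotients are expanded as formal power series in $q$. *)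

theory Defs
  imports "HOL-Analysis.Infinite_Products" "HOL-Computational_Algebra.Formal_Power_Series"
begin

text \<open>
  Infinite products of power series are those of \<^theory>\<open>HOL-Analysis.Infinite_Products\<close>, taken in
  the metric topology of \<^typ>\<open>'a fps\<close>. A sequence converges in this topology iff each coefficient is
  eventually equal to the corresponding coefficient of the limit (\<open>tendsto_fps_iff\<close>), so
  \<^const>\<open>convergent_prod\<close> expresses coefficientwise convergence. It also asks for a nonzero
  limit, which is no restriction when the factors have constant coefficient 1.
\<close>

definition qpoch_inf :: "'a::field fps \<Rightarrow> 'a fps \<Rightarrow> 'a fps" where
  "qpoch_inf z q = (\<Prod>i. 1 - z * q ^ i)"

text \<open>
  The series have integer coefficients; they are taken over \<open>\<rat>\<close> because division
  of power series in the library needs a coefficient type with inverses. The denominators below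
  are units, so the quotients are the usual expansions.
\<close>

definition F_series :: "nat \<Rightarrow> nat \<Rightarrow> nat \<Rightarrow> rat fps" where
  "F_series a b m =
     qpoch_inf (- (fps_X ^ (a + b))) (fps_X ^ m) /
     (qpoch_inf (- (fps_X ^ a)) (fps_X ^ m) * qpoch_inf (fps_X ^ b) (fps_X ^ m))"

definition R_series :: "nat \<Rightarrow> nat \<Rightarrow> rat fps" where
  "R_series A B = (1 + fps_X ^ (A + B)) / ((1 + fps_X ^ A) * (1 - fps_X ^ B))"

lemma has_prod_fps_coeffwise:
  fixes g :: "nat \<Rightarrow> 'a::field fps"
  assumes g: "\<And>i n. n \<le> i \<Longrightarrow> fps_nth (g i) n = 0"
  obtains p where "(\<lambda>i. 1 + g i) has_prod p" "fps_nth p 0 = 1"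
proof -
  define P where "P n = (\<Prod>i\<le>n. 1 + g i)" for n
  define p where "p = Abs_fps (\<lambda>k. fps_nth (P k) k)"
  have step: "fps_nth (P (Suc n)) k = fps_nth (P n) k" if "k \<le> n" for n k
  proof -
    have "P (Suc n) = P n + P n * g (Suc n)"
      by (simp add: P_def algebra_simps)
    moreover have "fps_nth (P n * g (Suc n)) k = 0"
      unfolding fps_mult_nth using that by (intro sum.neutral) (auto simp: g)
    ultimately show ?thesis by simp
  qed
  have stable: "fps_nth (P n) k = fps_nth (P k) k" if "k \<le> n" for n k
    using that by (induction rule: dec_induct) (auto simp: step)
  have "P \<longlonglongrightarrow> p"
    unfolding tendsto_fps_iff
  proof
    fix k
    show "\<forall>\<^sub>F n in sequentially. fps_nth (P n) k = fps_nth p k"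
      using eventually_ge_at_top[of k] by eventually_elim (auto simp: p_def intro: stable)
  qed
  moreover have p0: "fps_nth p 0 = 1"
    by (simp add: p_def P_def g)
  moreover from p0 have "p \<noteq> 0" by auto
  ultimately show thesis
    by (intro that[of p]) (simp_all add: has_prod_def raw_has_prod_def P_def[abs_def])
qed

lemma qpoch_inf_fps:
  fixes z q :: "'a::field fps"
  assumes "fps_nth z 0 = 0" "fps_nth q 0 = 0"
  shows "(\<lambda>i. 1 - z * q ^ i) has_prod qpoch_inf z q" and "fps_nth (qpoch_inf z q) 0 = 1"
proof -
  have "fps_nth (- (z * q ^ i)) n = 0" if "n \<le> i" for i n
  proof -
    have "fps_nth (z * q ^ i) n = (\<Sum>k=0..n. fps_nth z k * fps_nth (q ^ i) (n - k))"
      by (rule fps_mult_nth)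
    also have "\<dots> = 0"
    proof (intro sum.neutral ballI)
      fix k assume "k \<in> {0..n}"
      show "fps_nth z k * fps_nth (q ^ i) (n - k) = 0"
      proof (cases "k = 0")
        case False
        with that \<open>k \<in> {0..n}\<close> have "n - k < i" by auto
        with assms(2) show ?thesis by (simp add: startsby_zero_power_prefix)
      qed (use assms in simp)
    qed
    finally show ?thesis by simp
  qed
  from has_prod_fps_coeffwise[of "\<lambda>i. - (z * q ^ i)", OF this] obtain p
    where p: "(\<lambda>i. 1 - z * q ^ i) has_prod p" "fps_nth p 0 = 1"
    by auto
  from has_prod_unique[OF p(1)] have "qpoch_inf z q = p"
    by (simp add: qpoch_inf_def)
  with p show "(\<lambda>i. 1 - z * q ^ i) has_prod qpoch_inf z q" "fps_nth (qpoch_inf z q) 0 = 1"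
    by simp_all
qed

end

theory Submission
  imports Defs
begin

text \<open>
  As \<open>A\<^sub>j + B\<^sub>j = C\<^sub>2\<^sub>j\<close>, the numerators of the \<open>R\<close>-factors are the even-indexed factors of the
  numerator of \<open>F\<close>. Comparing the first \<open>2n\<close> of those with \<open>n\<close> factors of every other product gives
  an exact identity, and its limit is the theorem with the denominators cleared.
\<close>

text \<open>Coefficient \<open>k\<close> of a product involves only the coefficients of index at
  most \<open>k\<close> of the two factors. These are finitely many, so eventually all of them agree
  with those of the limits at once.\<close>

lemma tendsto_mult_fps:
  fixes f g :: "'b \<Rightarrow> 'a::ring_1 fps"
  assumes "(f \<longlongrightarrow> F) net" "(g \<longlongrightarrow> G) net"
  shows "((\<lambda>x. f x * g x) \<longlongrightarrow> F * G) net"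
proof (rule tendsto_fpsI)
  fix k
  have "\<forall>\<^sub>F x in net. \<forall>i\<in>{..k}. fps_nth (f x) i = fps_nth F i"
    using assms(1) by (intro eventually_ball_finite) (auto simp: tendsto_fps_iff)
  moreover have "\<forall>\<^sub>F x in net. \<forall>i\<in>{..k}. fps_nth (g x) i = fps_nth G i"
    using assms(2) by (intro eventually_ball_finite) (auto simp: tendsto_fps_iff)
  ultimately show "\<forall>\<^sub>F x in net. fps_nth (f x * g x) k = fps_nth (F * G) k"
    by eventually_elim (auto simp: fps_mult_nth intro!: sum.cong)
qed

lemma prod_even_odd:
  fixes f :: "nat \<Rightarrow> 'a::comm_monoid_mult"
  shows "(\<Prod>k<2 * n. f k) = (\<Prod>k<n. f (2 * k)) * (\<Prod>k<n. f (2 * k + 1))"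
  by (induction n) (simp_all add: ac_simps)

lemma R_series_mult_denominator:
  assumes "A > 0" "B > 0"
  shows "R_series A B * ((1 + fps_X ^ A) * (1 - fps_X ^ B)) = 1 + fps_X ^ (A + B)"
proof -
  have "is_unit ((1 + fps_X ^ A) * (1 - fps_X ^ B) :: rat fps)"
    using assms by (simp add: fps_is_unit_iff)
  then show ?thesis
    unfolding R_series_def by (meson dvd_div_mult_self unit_imp_dvd)
qed

text \<open>Numerator minus denominator of factor \<open>j\<close> is a combination of powers with
  exponents \<open>A j\<close>, \<open>B j\<close> and their sum, all above \<open>j\<close>.
  Division by a unit does not lower the order, so the factor is 1 plus a series of order above
  \<open>j\<close>.\<close>

lemma R_series_has_prod:
  assumes "\<And>j. j < A j" "\<And>j. j < B j"
  obtains p where "(\<lambda>j. R_series (A j) (B j)) has_prod p"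
proof -
  have coeff: "fps_nth (R_series (A j) (B j) - 1) n = 0" if "n \<le> j" for j n
  proof -
    define D :: "rat fps" where "D = (1 + fps_X ^ A j) * (1 - fps_X ^ B j)"
    have pos: "A j > 0" "B j > 0"
      using assms[of j] by simp_all
    have "fps_nth D 0 \<noteq> 0"
      using pos by (simp add: D_def)
    then have "R_series (A j) (B j) - 1 = (R_series (A j) (B j) - 1) * D * inverse D"
      by (simp add: mult.assoc inverse_mult_eq_1')
    also have "(R_series (A j) (B j) - 1) * D =
        fps_X ^ A j * (2 * fps_X ^ B j - 1) + fps_X ^ B j"
      using R_series_mult_denominator[OF pos] by (simp add: D_def algebra_simps power_add)
    finally show ?thesis
      using that assms[of j]
      by (simp add: distrib_right mult.assoc fps_X_power_mult_nth)
  qed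
  from has_prod_fps_coeffwise[of "\<lambda>j. R_series (A j) (B j) - 1", OF coeff] that
  show thesis by auto
qed

theorem proposition2p2:
  fixes a b m :: nat and A B C :: "nat \<Rightarrow> nat"
  assumes "a > 0" and "b > 0" and "m > 0"
  defines "A \<equiv> \<lambda>j. a + j * m"
    and "B \<equiv> \<lambda>j. b + j * m"
    and "C \<equiv> \<lambda>j. a + b + j * m"
  shows "convergent_prod (\<lambda>j. R_series (A j) (B j)) \<and>
         convergent_prod (\<lambda>j. 1 + fps_X ^ C (2 * j + 1) :: rat fps) \<and>
         F_series a b m =
           (\<Prod>j. R_series (A j) (B j)) * (\<Prod>j. 1 + fps_X ^ C (2 * j + 1))"
proof -
  \<comment> \<open>Because \<open>m > 0\<close>, each exponent exceeds its index, which is the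
    growth that makes both products on the right converge.\<close>
  have le: "j \<le> j * m" for j
    using assms(3) by simp
  have lt: "j < A j" "j < B j" "j < C j" for j
    using le[of j] assms(1,2) unfolding A_def B_def C_def by linarith+
  obtain r where r: "(\<lambda>j. R_series (A j) (B j)) has_prod r"
    by (rule R_series_has_prod[OF lt(1,2)])
  have "fps_nth (fps_X ^ C (2 * j + 1) :: rat fps) n = 0" if "n \<le> j" for j n
    using that lt(3)[of "2 * j + 1"] by simp
  then obtain s :: "rat fps" where s: "(\<lambda>j. 1 + fps_X ^ C (2 * j + 1)) has_prod s"
    by (rule has_prod_fps_coeffwise)

  define N Da Db :: "rat fps" where
    "N = qpoch_inf (- (fps_X ^ (a + b))) (fps_X ^ m)"
    and "Da = qpoch_inf (- (fps_X ^ a)) (fps_X ^ m)"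
    and "Db = qpoch_inf (fps_X ^ b) (fps_X ^ m)"
  have exponent: "x ^ c * (x ^ m) ^ j = x ^ (c + j * m)" for x :: "rat fps" and c j
    by (simp add: power_add mult.commute flip: power_mult)
  have N: "(\<lambda>j. 1 + fps_X ^ C j) has_prod N"
    using qpoch_inf_fps(1)[of "- (fps_X ^ (a + b))" "fps_X ^ m :: rat fps"] assms(1-3)
    by (simp add: N_def C_def exponent)
  have Da: "(\<lambda>j. 1 + fps_X ^ A j) has_prod Da" "fps_nth Da 0 = 1"
    using qpoch_inf_fps[of "- (fps_X ^ a)" "fps_X ^ m :: rat fps"] assms(1-3)
    by (simp_all add: Da_def A_def exponent)
  have Db: "(\<lambda>j. 1 - fps_X ^ B j) has_prod Db" "fps_nth Db 0 = 1"
    using qpoch_inf_fps[of "fps_X ^ b" "fps_X ^ m :: rat fps"] assms(1-3)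
    by (simp_all add: Db_def B_def exponent)

  have factor: "R_series (A j) (B j) * ((1 + fps_X ^ A j) * (1 - fps_X ^ B j)) =
      1 + fps_X ^ C (2 * j)" for j
  proof -
    have "A j + B j = C (2 * j)"
      by (simp add: A_def B_def C_def algebra_simps)
    then show ?thesis
      using R_series_mult_denominator[of "A j" "B j"] lt[of j] by simp
  qed
  have "(\<Prod>k<2 * n. 1 + fps_X ^ C k :: rat fps) =
      ((\<Prod>j<n. R_series (A j) (B j)) * (\<Prod>j<n. 1 + fps_X ^ C (2 * j + 1))) *
      ((\<Prod>j<n. 1 + fps_X ^ A j) * (\<Prod>j<n. 1 - fps_X ^ B j))" for n
    \<comment> \<open>After the split by parity, \<open>factor\<close> read backwards turns each
      even-indexed factor into an \<open>R_series\<close> term times its denominator.\<close>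
    unfolding prod_even_odd factor[symmetric] prod.distrib by (simp only: ac_simps)
  \<comment> \<open>The partial products of even length form a subsequence, so they keep the limit
    \<open>N\<close>.\<close>
  moreover have "(\<lambda>n. \<Prod>k<2 * n. 1 + fps_X ^ C k) \<longlonglongrightarrow> N"
    by (rule filterlim_compose[OF has_prod_imp_tendsto'[OF N]])
      (simp add: mult_nat_left_at_top)
  ultimately have "(\<lambda>n. ((\<Prod>j<n. R_series (A j) (B j)) * (\<Prod>j<n. 1 + fps_X ^ C (2 * j + 1))) *
      ((\<Prod>j<n. 1 + fps_X ^ A j) * (\<Prod>j<n. 1 - fps_X ^ B j))) \<longlonglongrightarrow> N"
    by simp
  moreover have "(\<lambda>n. ((\<Prod>j<n. R_series (A j) (B j)) * (\<Prod>j<n. 1 + fps_X ^ C (2 * j + 1))) *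
      ((\<Prod>j<n. 1 + fps_X ^ A j) * (\<Prod>j<n. 1 - fps_X ^ B j))) \<longlonglongrightarrow> (r * s) * (Da * Db)"
    by (intro tendsto_mult_fps has_prod_imp_tendsto' r s Da Db)
  ultimately have "N = (r * s) * (Da * Db)"
    by (rule LIMSEQ_unique)
  \<comment> \<open>Both constant coefficients are 1. Hence the denominator of
    \<open>F_series\<close> is nonzero and cancels against the same factor of
    \<open>N\<close>.\<close>
  moreover have "Da * Db \<noteq> 0"
    using Da(2) Db(2) by auto
  ultimately have "F_series a b m = r * s"
    by (simp add: F_series_def flip: N_def Da_def Db_def)
  then show ?thesis
    using has_prod_unique[OF r] has_prod_unique[OF s] r s
    by (auto simp: convergent_prod_def has_prod_def dest: has_prod_0D)
qed

end
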